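(* Let $n\geq 3$ and let $K_{n,n}=G(U,V)$ be an edge-colored complete bipartite graph containing no rainbow copy of $K_{1,3}$. Let $k$ be the number of colors used in the edge-coloring. Then, after renumbering the colors and interchanging $U$ and $V$ if necessary, one of the following holds: (a) at most two colors are used; (b) $U$ can be partitioned into $k$ parts $U_1,U_2,\ldots,U_k$ with $|U_1|\geq 0$ and $|U_i|\geq 1$ for $i=2,\ldots,k$, and $V$ can be partitioned into $k$ parts $V_1,V_2,\ldots,V_k$ with $|V_1|\geq 0$ and $|V_i|\geq 1$ for $i=2,\ldots,k$, such that only colors $1$ and $i$ can be used on the edges of $E(U_i,V_i)$ for $i=1,2,\ldots,k$, and every other edge is colored by color $1$; (c) $U$ can be partitioned into $3$ parts $U_1,U_2,U_3$ such that each part is incident with at most two colors from $\{1,2,3\}$, and $V$ can be partitioned into $3$ parts $V_1,V_2,V_3$ such that each part is incident with at most two colors from $\{1,2,3\}$; (d) $U$ can be partitioned into $3$ parts $U_1,U_2,U_3$ such that each part is incident with exactly two colors, the pair of colors being one of $\{1,2\}$, $\{2,3\}$ or $\{1,4\}$, and $V$ can be partitioned into $3$ parts $V_1,V_2,V_3$ such that each part is incident with exactly two colors, the pair of colors being one of $\{1,2\}$, $\{1,3\}$ or $\{2,4\}$; (e) $U$ can be partitioned into $2$ parts $U_1$ and $U_2$, and $V$ can be partitioned into $4$ parts $V_1,V_2,V_3,V_4$ (where it is possible that $V_i=\emptyset$ for some $i\in\{1,2,3,4\}$) such that $c(U_1,V_1\cup V_2)=1$, $c(U_1,V_3\cup V_4)=4$,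 $c(U_2,V_1\cup V_3)=2$ and $c(U_2,V_2\cup V_4)=3$.
   Context: All graphs are finite, simple and undirected. $G(U,V)$ denotes the complete bipartite graph with bipartition $(U,V)$, where $|U|=|V|=n$. Edge-colorings are arbitrary (not necessarily proper) assignments of colors to edges, and the coloring is exact: each of the $k$ colors is used on at least one edge. A subgraph is rainbow if no two of its edges have the same color. For vertex sets $S,T$, $E(S,T)$ is the set of edges with one end in $S$ and the other in $T$; $c(S,T)=i$ means that all edges between $S$ and $T$ have color $i$. A vertex subset $V'$ is incident with $t$ colors if all the edges incident with vertices of $V'$ are colored by exactly $t$ colors in total (so "at most two colors from $\{1,2,3\}$" means that the set of all colors on edges incident with vertices of the part is a subset of $\{1,2,3\}$ of size at most two). *)

theory Defs
  imports Main "HOL-Library.Disjoint_Sets"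
begin

text \<open>An edge is the two-element set of its ends, a graph without isolated vertices is given
  by its edge set, and an edge-coloring is a function on edges of which only the values on the
  edge set of the graph matter.\<close>

definition complete_bipartite_edges :: "'a set \<Rightarrow> 'a set \<Rightarrow> 'a set set" where
  "complete_bipartite_edges U V = {{u, v} | u v. u \<in> U \<and> v \<in> V}"

definition is_complete_bipartite :: "nat \<Rightarrow> nat \<Rightarrow> 'a set set \<Rightarrow> bool" where
  "is_complete_bipartite s t F \<longleftrightarrow>
     (\<exists>A B. finite A \<and> finite B \<and> A \<inter> B = {} \<and> card A = s \<and> card B = t \<and>
        F = complete_bipartite_edges A B)"

definition rainbow :: "('a set \<Rightarrow> 'c) \<Rightarrow> 'a set set \<Rightarrow> bool" where
  "rainbow c F \<longleftrightarrow> inj_on c F"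

definition contains_rainbow_complete_bipartite ::
    "nat \<Rightarrow> nat \<Rightarrow> 'a set set \<Rightarrow> ('a set \<Rightarrow> 'c) \<Rightarrow> bool" where
  "contains_rainbow_complete_bipartite s t E c \<longleftrightarrow>
     (\<exists>F. F \<subseteq> E \<and> is_complete_bipartite s t F \<and> rainbow c F)"

definition edges_between :: "'a set set \<Rightarrow> 'a set \<Rightarrow> 'a set \<Rightarrow> 'a set set" where
  "edges_between E S T = {e \<in> E. \<exists>s\<in>S. \<exists>t\<in>T. e = {s, t}}"

definition incident_colors :: "'a set set \<Rightarrow> ('a set \<Rightarrow> 'c) \<Rightarrow> 'a set \<Rightarrow> 'c set" where
  "incident_colors E c W = c ` {e \<in> E. e \<inter> W \<noteq> {}}"

text \<open>The relation written \<open>c(S,T) = i\<close>; it holds vacuously if \<open>S\<close> or \<open>T\<close> is empty.\<close>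

definition all_colored :: "'a set set \<Rightarrow> ('a set \<Rightarrow> 'c) \<Rightarrow> 'a set \<Rightarrow> 'a set \<Rightarrow> 'c \<Rightarrow> bool" where
  "all_colored E c S T i \<longleftrightarrow> (\<forall>e\<in>edges_between E S T. c e = i)"

text \<open>Parts may be empty here; nonemptiness is stated separately wherever it is required.\<close>

definition indexed_partition :: "'a set \<Rightarrow> 'i set \<Rightarrow> ('i \<Rightarrow> 'a set) \<Rightarrow> bool" where
  "indexed_partition A I P \<longleftrightarrow> disjoint_family_on P I \<and> (\<Union>i\<in>I. P i) = A"

text \<open>In the following structures the colors are already numbered \<open>1, \<dots>, k\<close>.\<close>

definition structure_b ::
    "'a set \<Rightarrow> 'a set \<Rightarrow> 'a set set \<Rightarrow> ('a set \<Rightarrow> nat) \<Rightarrow> nat \<Rightarrow> bool" where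
  "structure_b U V E c k \<longleftrightarrow>
     (\<exists>P Q. indexed_partition U {1..k} P \<and> indexed_partition V {1..k} Q \<and>
        (\<forall>i\<in>{2..k}. P i \<noteq> {} \<and> Q i \<noteq> {}) \<and>
        (\<forall>i\<in>{1..k}. c ` edges_between E (P i) (Q i) \<subseteq> {1, i}) \<and>
        (\<forall>e\<in>E - (\<Union>i\<in>{1..k}. edges_between E (P i) (Q i)). c e = 1))"

definition structure_c :: "'a set \<Rightarrow> 'a set \<Rightarrow> 'a set set \<Rightarrow> ('a set \<Rightarrow> nat) \<Rightarrow> bool" where
  "structure_c U V E c \<longleftrightarrow>
     (\<exists>P Q. indexed_partition U {1..3::nat} P \<and> indexed_partition V {1..3::nat} Q \<and>
        (\<forall>i\<in>{1..3}. P i \<noteq> {} \<and> Q i \<noteq> {}) \<and>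
        (\<forall>i\<in>{1..3}. incident_colors E c (P i) \<subseteq> {1, 2, 3} \<and>
                     card (incident_colors E c (P i)) \<le> 2) \<and>
        (\<forall>i\<in>{1..3}. incident_colors E c (Q i) \<subseteq> {1, 2, 3} \<and>
                     card (incident_colors E c (Q i)) \<le> 2))"

definition structure_d :: "'a set \<Rightarrow> 'a set \<Rightarrow> 'a set set \<Rightarrow> ('a set \<Rightarrow> nat) \<Rightarrow> bool" where
  "structure_d U V E c \<longleftrightarrow>
     (\<exists>P Q. indexed_partition U {1..3::nat} P \<and> indexed_partition V {1..3::nat} Q \<and>
        (\<forall>i\<in>{1..3}. P i \<noteq> {} \<and> Q i \<noteq> {}) \<and>
        (\<forall>i\<in>{1..3}. incident_colors E c (P i) \<in> {{1, 2}, {2, 3}, {1, 4}}) \<and>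
        (\<forall>i\<in>{1..3}. incident_colors E c (Q i) \<in> {{1, 2}, {1, 3}, {2, 4}}))"

definition structure_e :: "'a set \<Rightarrow> 'a set \<Rightarrow> 'a set set \<Rightarrow> ('a set \<Rightarrow> nat) \<Rightarrow> bool" where
  "structure_e U V E c \<longleftrightarrow>
     (\<exists>P Q. indexed_partition U {1..2::nat} P \<and> indexed_partition V {1..4::nat} Q \<and>
        (\<forall>i\<in>{1..2}. P i \<noteq> {}) \<and>
        all_colored E c (P 1) (Q 1 \<union> Q 2) 1 \<and>
        all_colored E c (P 1) (Q 3 \<union> Q 4) 4 \<and>
        all_colored E c (P 2) (Q 1 \<union> Q 3) 2 \<and>
        all_colored E c (P 2) (Q 2 \<union> Q 4) 3)"

end

theory Submission
  imports Defs
begin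

text \<open>
  Call the set of colors on the edges at a vertex its palette. A rainbow \<open>K\<^bsub>1,3\<^esub>\<close> is a star whose
  center has three colors in its palette, so the hypothesis says that every palette has at most
  two elements. Since the edge \<open>uv\<close> has a color, the palette of every \<open>u \<in> U\<close> meets the palette of
  every \<open>v \<in> V\<close>. Hence the palettes of the two sides are two cross-intersecting families of sets
  with at most two elements, both of which cover the set of all \<open>k\<close> colors, and the theorem is a
  classification of such pairs of families.

  For \<open>k = 3\<close> every palette misses a color; grouping the vertices by a missed color, and refining
  the grouping if it has fewer than three classes, gives (c). Let \<open>k \<ge> 4\<close>. If one family has a
  common element, then so has the other one (lemma \<open>common_color_transfer\<close>), and the common color
  plays the role of color \<open>1\<close> in (b). Otherwise neither family is a star, and neither is a triangle
  because a triangle has only three vertices. So both families contain two disjoint members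
  (lemma \<open>intersecting_pairs\<close>). The cross-intersection of these four sets shows that they
  are the sides of a 4-cycle \<open>pqrs\<close>, with \<open>{p, s}, {q, r}\<close> in one family and \<open>{p, q}, {r, s}\<close> in
  the other one. This leaves only the diagonals \<open>{p, r}\<close> and \<open>{q, s}\<close> as further members. One
  family has no diagonal, which is (e), or both contain the same single diagonal, which is (d)
  (lemma \<open>cross_intersecting_pairs\<close>).
\<close>

section \<open>Cross-intersecting families of sets with at most two elements\<close>

lemma eq_pair_if_card_le_2:
  assumes "finite X" "card X \<le> 2" "x \<in> X" "y \<in> X" "x \<noteq> y"
  shows "X = {x, y}"
  using card_seteq[of X "{x, y}"] assms by auto

lemma two_optional_members:
  assumes "{x, y} \<subseteq> S" "S \<subseteq> {x, y, v, w}"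
  shows "v \<notin> S \<Longrightarrow> w \<notin> S \<Longrightarrow> S = {x, y}"
    and "v \<in> S \<Longrightarrow> w \<notin> S \<Longrightarrow> S = {v, x, y}"
    and "v \<notin> S \<Longrightarrow> w \<in> S \<Longrightarrow> S = {w, x, y}"
  using assms by blast+

text \<open>A member \<open>X\<close> avoiding \<open>x\<close> would have to contain each of the at least three other points \<open>y\<close>,
  because it meets every member of the other family, and one of these is \<open>{x, y}\<close>.\<close>

lemma common_color_transfer:
  fixes R C :: "'c set set"
  assumes fin: "\<And>X. X \<in> R \<union> C \<Longrightarrow> finite X" and card_le: "\<And>X. X \<in> R \<union> C \<Longrightarrow> card X \<le> 2"
    and cross: "\<And>X Y. X \<in> R \<Longrightarrow> Y \<in> C \<Longrightarrow> X \<inter> Y \<noteq> {}"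
    and large: "card (\<Union>C) \<ge> 4"
    and common: "\<And>Y. Y \<in> C \<Longrightarrow> x \<in> Y" and "X \<in> R"
  shows "x \<in> X"
proof (rule ccontr)
  assume "x \<notin> X"
  have "y \<in> X" if y: "y \<in> \<Union>C - {x}" for y
  proof -
    obtain Y where Y: "Y \<in> C" "y \<in> Y" using y by blast
    then have "Y = {y, x}"
      using eq_pair_if_card_le_2[of Y y x] fin card_le common y by auto
    then show ?thesis using cross[OF \<open>X \<in> R\<close> Y(1)] \<open>x \<notin> X\<close> by auto
  qed
  then have "card (\<Union>C - {x}) \<le> card X"
    using fin \<open>X \<in> R\<close> by (intro card_mono) auto
  moreover have "card (\<Union>C) - 1 \<le> card (\<Union>C - {x})"
    by (simp add: card_Diff_singleton_if)
  ultimately show False using card_le[of X] \<open>X \<in> R\<close> large by auto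
qed

text \<open>An intersecting family of edges is a star or a triangle, and a triangle has three vertices.\<close>

lemma intersecting_pairs:
  fixes R :: "'c set set"
  assumes fin: "\<And>X. X \<in> R \<Longrightarrow> finite X" and card_le: "\<And>X. X \<in> R \<Longrightarrow> card X \<le> 2"
    and inter: "\<And>X Y. X \<in> R \<Longrightarrow> Y \<in> R \<Longrightarrow> X \<inter> Y \<noteq> {}"
    and no_common: "\<nexists>x. \<forall>X\<in>R. x \<in> X"
  shows "card (\<Union>R) \<le> 3"
proof -
  obtain X where "X \<in> R" using no_common by blast
  then obtain a where a: "a \<in> X" using inter by blast
  obtain Y where Y: "Y \<in> R" "a \<notin> Y" using no_common by blast
  then obtain b where b: "b \<in> X" "b \<in> Y" using inter \<open>X \<in> R\<close> by blast
  obtain Z where Z: "Z \<in> R" "b \<notin> Z" using no_common by blast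
  then obtain y where y: "y \<in> Y" "y \<in> Z" using inter Y by blast
  have "a \<noteq> b" "b \<noteq> y" "a \<noteq> y" using Y Z b y by auto
  have X_eq: "X = {a, b}" and Y_eq: "Y = {b, y}"
    using eq_pair_if_card_le_2 fin card_le \<open>X \<in> R\<close> Y Z a b y \<open>a \<noteq> b\<close> \<open>b \<noteq> y\<close> by metis+
  then have "a \<in> Z" using inter[OF \<open>X \<in> R\<close> Z(1)] Z by auto
  then have Z_eq: "Z = {a, y}"
    using eq_pair_if_card_le_2 fin card_le Z y \<open>a \<noteq> y\<close> by metis
  have "W \<subseteq> {a, b, y}" if "W \<in> R" for W
  proof -
    \<comment> \<open>A set meeting all three sides of the triangle contains two of its vertices.\<close>
    have "(a \<in> W \<and> b \<in> W) \<or> (b \<in> W \<and> y \<in> W) \<or> (a \<in> W \<and> y \<in> W)"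
      using inter[OF \<open>X \<in> R\<close> that] inter[OF Y(1) that] inter[OF Z(1) that] X_eq Y_eq Z_eq
      by auto
    then show ?thesis
      using eq_pair_if_card_le_2[OF fin[OF that] card_le[OF that]] \<open>a \<noteq> b\<close> \<open>b \<noteq> y\<close> \<open>a \<noteq> y\<close>
      by blast
  qed
  then have "card (\<Union>R) \<le> card {a, b, y}" by (intro card_mono) auto
  also have "\<dots> \<le> 3" by (simp add: card_insert_if)
  finally show ?thesis .
qed

text \<open>The four sides of the 4-cycle \<open>pqrs\<close> arise as the members of two disjoint pairs, \<open>X, Y\<close> in one
  family and \<open>Z, W\<close> in the other one, and its vertices as the points in which these sets cross.
  A diagonal in one family excludes the opposite diagonal from the other one.\<close>

lemma cross_intersecting_pairs:
  fixes R C :: "'c set set"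
  assumes fin: "\<And>X. X \<in> R \<union> C \<Longrightarrow> finite X" and card_le: "\<And>X. X \<in> R \<union> C \<Longrightarrow> card X \<le> 2"
    and cross: "\<And>X Y. X \<in> R \<Longrightarrow> Y \<in> C \<Longrightarrow> X \<inter> Y \<noteq> {}"
    and union: "\<Union>R = K" "\<Union>C = K" and large: "card K \<ge> 4"
    and no_common: "\<nexists>x. \<forall>X\<in>R \<union> C. x \<in> X"
  obtains p q r s where "distinct [p, q, r, s]" "K = {p, q, r, s}"
    and "R = {{p, s}, {q, r}} \<and> C \<subseteq> {{p, q}, {p, r}, {q, s}, {r, s}} \<or>
         C = {{p, s}, {q, r}} \<and> R \<subseteq> {{p, q}, {p, r}, {q, s}, {r, s}} \<or>
         R = {{p, q}, {q, r}, {p, s}} \<and> C = {{p, q}, {p, r}, {q, s}}"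
proof -
  have cross': "\<And>X Y. X \<in> C \<Longrightarrow> Y \<in> R \<Longrightarrow> X \<inter> Y \<noteq> {}" using cross by blast
  have no_common_R: "\<nexists>x. \<forall>X\<in>R. x \<in> X"
  proof
    assume "\<exists>x. \<forall>X\<in>R. x \<in> X"
    then obtain x where x: "\<And>X. X \<in> R \<Longrightarrow> x \<in> X" by blast
    have "x \<in> Y" if "Y \<in> C" for Y
      by (rule common_color_transfer[of C R]) (use x that fin card_le cross' union large in auto)
    then show False using x no_common by blast
  qed
  have no_common_C: "\<nexists>x. \<forall>X\<in>C. x \<in> X"
  proof
    assume "\<exists>x. \<forall>X\<in>C. x \<in> X"
    then obtain x where x: "\<And>X. X \<in> C \<Longrightarrow> x \<in> X" by blast
    have "x \<in> Y" if "Y \<in> R" for Y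
      by (rule common_color_transfer[of R C]) (use x that fin card_le cross union large in auto)
    then show False using x no_common by blast
  qed
  obtain X Y where XY: "X \<in> R" "Y \<in> R" "X \<inter> Y = {}"
    using intersecting_pairs[of R] no_common_R fin card_le union large by fastforce
  obtain Z W where ZW: "Z \<in> C" "W \<in> C" "Z \<inter> W = {}"
    using intersecting_pairs[of C] no_common_C fin card_le union large by fastforce
  obtain a b c d where abcd: "a \<in> X \<inter> Z" "b \<in> Y \<inter> Z" "c \<in> Y \<inter> W" "d \<in> X \<inter> W"
    using cross XY ZW by (metis ex_in_conv)
  have dist: "distinct [a, b, c, d]" using abcd XY ZW by auto
  then have neq: "a \<noteq> b" "a \<noteq> c" "a \<noteq> d" "b \<noteq> c" "b \<noteq> d" "c \<noteq> d" by auto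
  have pair: "T = {x, y}" if "T \<in> R \<union> C" "x \<in> T" "y \<in> T" "x \<noteq> y" for T x y
    using eq_pair_if_card_le_2[OF fin card_le] that by blast
  have eqs: "X = {a, d}" "Y = {b, c}" "Z = {a, b}" "W = {c, d}"
    by (rule pair; use abcd neq XY ZW in blast)+
  have R_sub: "R \<subseteq> {{a, d}, {b, c}, {a, c}, {b, d}}"
  proof
    fix T assume T: "T \<in> R"
    have "(a \<in> T \<or> b \<in> T) \<and> (c \<in> T \<or> d \<in> T)"
      using cross[OF T ZW(1)] cross[OF T ZW(2)] eqs by auto
    then have "T = {a, d} \<or> T = {b, c} \<or> T = {a, c} \<or> T = {b, d}"
      using pair[OF UnI1[OF T]] neq by metis
    then show "T \<in> {{a, d}, {b, c}, {a, c}, {b, d}}" by blast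
  qed
  have C_sub: "C \<subseteq> {{a, b}, {c, d}, {a, c}, {b, d}}"
  proof
    fix T assume T: "T \<in> C"
    have "(a \<in> T \<or> d \<in> T) \<and> (b \<in> T \<or> c \<in> T)"
      using cross[OF XY(1) T] cross[OF XY(2) T] eqs by auto
    then have "T = {a, b} \<or> T = {c, d} \<or> T = {a, c} \<or> T = {b, d}"
      using pair[OF UnI2[OF T]] neq by metis
    then show "T \<in> {{a, b}, {c, d}, {a, c}, {b, d}}" by blast
  qed
  have sides: "{{a, d}, {b, c}} \<subseteq> R" "{{a, b}, {c, d}} \<subseteq> C" using XY ZW eqs by auto
  have K_eq: "K = {a, b, c, d}" using R_sub sides union(1) by auto
  have opposite: "\<not> ({a, c} \<in> R \<and> {b, d} \<in> C)" "\<not> ({b, d} \<in> R \<and> {a, c} \<in> C)"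
    using cross dist by fastforce+
  note R_cases = two_optional_members[OF sides(1) R_sub]
  note C_cases = two_optional_members[OF sides(2) C_sub]
  consider "{a, c} \<notin> R" "{b, d} \<notin> R" | "{a, c} \<notin> C" "{b, d} \<notin> C"
    | "{a, c} \<in> R" "{a, c} \<in> C" "{b, d} \<notin> R" "{b, d} \<notin> C"
    | "{b, d} \<in> R" "{b, d} \<in> C" "{a, c} \<notin> R" "{a, c} \<notin> C"
    using opposite by argo
  then show thesis
  proof cases
    case 1
    then have "R = {{a, d}, {b, c}}" by (rule R_cases(1))
    moreover have "C \<subseteq> {{a, b}, {a, c}, {b, d}, {c, d}}"
      using C_sub by (simp only: insert_commute)
    ultimately show thesis by (intro that[OF dist K_eq] disjI1 conjI)
  next
    case 2
    then have "C = {{a, b}, {c, d}}" by (rule C_cases(1))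
    then have "C = {{a, b}, {d, c}}" by (simp only: insert_commute)
    moreover have "R \<subseteq> {{a, d}, {a, c}, {d, b}, {c, b}}" using R_sub by (simp only: insert_commute)
    moreover have "distinct [a, d, c, b]" "K = {a, d, c, b}" using dist K_eq by auto
    ultimately show thesis
      by (intro that[of a d c b, OF _ _ disjI2[OF disjI1[OF conjI]]])
  next
    case 3
    then have "R = {{a, c}, {a, d}, {b, c}}" "C = {{a, c}, {a, b}, {c, d}}"
      using R_cases(2) C_cases(2) by simp_all
    then have "R = {{a, c}, {c, b}, {a, d}}" "C = {{a, c}, {a, b}, {c, d}}"
      by (simp_all only: insert_commute)
    moreover have "distinct [a, c, b, d]" "K = {a, c, b, d}" using dist K_eq by auto
    ultimately show thesis
      by (intro that[of a c b d, OF _ _ disjI2[OF disjI2[OF conjI]]])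
  next
    case 4
    then have "R = {{b, d}, {a, d}, {b, c}}" "C = {{b, d}, {a, b}, {c, d}}"
      using R_cases(3) C_cases(3) by simp_all
    then have "R = {{d, b}, {b, c}, {d, a}}" "C = {{d, b}, {d, c}, {b, a}}"
      by (simp_all only: insert_commute)
    moreover have "distinct [d, b, c, a]" "K = {d, b, c, a}" using dist K_eq by auto
    ultimately show thesis
      by (intro that[of d b c a, OF _ _ disjI2[OF disjI2[OF conjI]]])
  qed
qed

section \<open>Partitions from classifying functions\<close>

lemma indexed_partition_fibres:
  assumes "inj_on F I" "h ` A \<subseteq> F ` I"
  shows "indexed_partition A I (\<lambda>i. {x \<in> A. h x = F i})"
  unfolding indexed_partition_def
proof
  show "disjoint_family_on (\<lambda>i. {x \<in> A. h x = F i}) I"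
    using inj_onD[OF assms(1)] unfolding disjoint_family_on_def by auto
  show "(\<Union>i\<in>I. {x \<in> A. h x = F i}) = A"
    using assms(2) by blast
qed

text \<open>To refine the partition into the fibres of \<open>g\<close> to exactly \<open>m\<close> classes, choose a
  representative of each fibre and add further elements up to \<open>m\<close> of them. The added elements
  become singleton classes, and all others join their representative.\<close>

lemma refine_fibres:
  fixes g :: "'a \<Rightarrow> 'b"
  assumes "finite A" "card (g ` A) \<le> m" "m \<le> card A"
  obtains h :: "'a \<Rightarrow> nat" where "h ` A = {1..m}"
    and "\<And>x y. x \<in> A \<Longrightarrow> y \<in> A \<Longrightarrow> h x = h y \<Longrightarrow> g x = g y"
proof -
  obtain D where D: "D \<subseteq> A" "inj_on g D" "g ` A = g ` D"
    using subset_image_inj[of "g ` A" g A] by blast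
  then have "card D \<le> m" using card_image[of g D] assms by simp
  then obtain D' where D': "D \<subseteq> D'" "D' \<subseteq> A" "card D' = m"
    using exists_subset_between[of D m A] assms D by blast
  have "finite D'" using D' assms finite_subset by blast
  then obtain b where b: "bij_betw b D' {1..m}"
    using finite_same_card_bij[of D' "{1..m}"] D' by auto
  define r where "r x = (if x \<in> D' then x else SOME d. d \<in> D \<and> g d = g x)" for x
  have r: "r x \<in> D' \<and> g (r x) = g x" if "x \<in> A" for x
  proof (cases "x \<in> D'")
    case False
    have "g x \<in> g ` D" using D(3) that by blast
    then have "\<exists>d. d \<in> D \<and> g d = g x" by auto
    then have "(SOME d. d \<in> D \<and> g d = g x) \<in> D \<and> g (SOME d. d \<in> D \<and> g d = g x) = g x"
      by (rule someI_ex)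
    then show ?thesis using False D' by (auto simp: r_def)
  qed (simp add: r_def)
  show thesis
  proof (rule that[of "b \<circ> r"])
    have "r x = x" if "x \<in> D'" for x using that by (simp add: r_def)
    then have "D' \<subseteq> r ` A" using D'(2) by (metis image_eqI subset_iff)
    then have "r ` A = D'" using r by blast
    then show "(b \<circ> r) ` A = {1..m}"
      using bij_betw_imp_surj_on[OF b] by (simp only: image_comp[symmetric])
  next
    fix x y assume "x \<in> A" "y \<in> A" "(b \<circ> r) x = (b \<circ> r) y"
    then have "r x = r y" using b r \<open>x \<in> A\<close> \<open>y \<in> A\<close> by (auto simp: bij_betw_def inj_on_def)
    then show "g x = g y" using r[OF \<open>x \<in> A\<close>] r[OF \<open>y \<in> A\<close>] by simp
  qed
qed

section \<open>Palettes\<close>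

lemma incident_colors_eq_Union:
  "incident_colors E c W = (\<Union>w\<in>W. incident_colors E c {w})"
  unfolding incident_colors_def by blast

lemma incident_colors_comp:
  "incident_colors E (\<sigma> \<circ> c) W = \<sigma> ` incident_colors E c W"
  unfolding incident_colors_def by (simp add: image_comp)

lemma complete_bipartite_edges_commute:
  "complete_bipartite_edges A B = complete_bipartite_edges B A"
  unfolding complete_bipartite_edges_def by (auto simp: insert_commute)

lemma incident_colors_vertex:
  assumes "A \<inter> B = {}" "w \<in> A"
  shows "incident_colors (complete_bipartite_edges A B) c {w} = (\<lambda>v. c {w, v}) ` B"
  using assms unfolding incident_colors_def complete_bipartite_edges_def by fastforce

lemma card_palette_le_2:
  assumes "A \<inter> B = {}" "E = complete_bipartite_edges A B"
    and no_rainbow: "\<not> contains_rainbow_complete_bipartite 1 3 E c"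
    and "w \<in> A"
  shows "card (incident_colors E c {w}) \<le> 2"
proof (rule ccontr)
  assume "\<not> ?thesis"
  then have "3 \<le> card ((\<lambda>v. c {w, v}) ` B)"
    using incident_colors_vertex[OF assms(1) \<open>w \<in> A\<close>, of c] assms by simp
  then obtain T where T: "T \<subseteq> (\<lambda>v. c {w, v}) ` B" "card T = 3" "finite T"
    by (rule obtain_subset_with_card_n)
  then obtain X where X: "X \<subseteq> B" "inj_on (\<lambda>v. c {w, v}) X" "T = (\<lambda>v. c {w, v}) ` X"
    unfolding subset_image_inj by blast
  then have "card X = 3" using T(2) card_image[OF X(2)] by simp
  then have "finite X" using card_ge_0_finite[of X] by simp
  let ?F = "complete_bipartite_edges {w} X"
  have "is_complete_bipartite 1 3 ?F"
    unfolding is_complete_bipartite_def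
    using X(1) \<open>card X = 3\<close> \<open>finite X\<close> \<open>w \<in> A\<close> assms(1)
    by (intro exI[of _ "{w}"] exI[of _ X]) auto
  moreover have "rainbow c ?F"
    using X(2) unfolding rainbow_def inj_on_def complete_bipartite_edges_def by auto
  moreover have "?F \<subseteq> E"
    using X(1) \<open>w \<in> A\<close> assms(2) unfolding complete_bipartite_edges_def by auto
  ultimately show False
    using no_rainbow unfolding contains_rainbow_complete_bipartite_def by blast
qed

text \<open>In this form the hypothesis on the coloring is symmetric in the two sides and is preserved
  under renaming colors.\<close>

locale two_color_palettes =
  fixes A B :: "'a set" and E :: "'a set set" and c :: "'a set \<Rightarrow> 'c"
  assumes finite: "finite A" "finite B"
    and disjoint: "A \<inter> B = {}"
    and card_ge_3: "3 \<le> card A" "3 \<le> card B"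
    and edges: "E = complete_bipartite_edges A B"
    and card_palette: "w \<in> A \<union> B \<Longrightarrow> card (incident_colors E c {w}) \<le> 2"
begin

abbreviation palette :: "'a \<Rightarrow> 'c set" where
  "palette w \<equiv> incident_colors E c {w}"

lemma swap: "two_color_palettes B A E c"
  by unfold_locales
    (use finite disjoint card_ge_3 edges card_palette complete_bipartite_edges_commute[of A B]
      in auto)

lemma recolor: "two_color_palettes A B E (\<sigma> \<circ> c)"
proof unfold_locales
  have "E \<subseteq> Pow (A \<union> B)" using edges by (auto simp: complete_bipartite_edges_def)
  then have "finite E" using finite by (meson finite_Pow_iff finite_UnI finite_subset)
  then have "finite (palette w)" for w by (simp add: incident_colors_def)
  then show "card (incident_colors E (\<sigma> \<circ> c) {w}) \<le> 2" if "w \<in> A \<union> B" for w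
    using card_palette[OF that] card_image_le[of "palette w" \<sigma>]
    by (simp add: incident_colors_comp)
qed (use finite disjoint card_ge_3 edges in auto)

lemma palette_left: "u \<in> A \<Longrightarrow> palette u = (\<lambda>v. c {u, v}) ` B"
  using incident_colors_vertex disjoint edges by metis

lemma finite_palette_left: "u \<in> A \<Longrightarrow> finite (palette u)"
  using palette_left finite by simp

lemma edge_color_in_palettes:
  assumes "u \<in> A" "v \<in> B"
  shows "c {u, v} \<in> palette u \<inter> palette v"
  using assms edges unfolding incident_colors_def complete_bipartite_edges_def by blast

lemma Union_palettes_left: "(\<Union>u\<in>A. palette u) = c ` E"
  using edges unfolding incident_colors_def complete_bipartite_edges_def by blast

lemma edges_cases:
  assumes "e \<in> E"
  obtains u v where "e = {u, v}" "u \<in> A" "v \<in> B"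
  using assms edges unfolding complete_bipartite_edges_def by blast

lemma edges_between_cases:
  assumes "e \<in> edges_between E S T"
  obtains u v where "e = {u, v}" "u \<in> S" "v \<in> T"
  using assms unfolding edges_between_def by blast

lemma all_coloredI:
  assumes "S \<subseteq> A" "T \<subseteq> B" "\<And>u v. u \<in> S \<Longrightarrow> v \<in> T \<Longrightarrow> palette u \<inter> palette v \<subseteq> {i}"
  shows "all_colored E c S T i"
  unfolding all_colored_def
proof
  fix e assume "e \<in> edges_between E S T"
  then obtain u v where "e = {u, v}" "u \<in> S" "v \<in> T"
    by (rule edges_between_cases)
  then show "c e = i"
    using edge_color_in_palettes[of u v] assms by blast
qed

text \<open>If there are only three colors, each vertex can be put in a class according to a color that
  its palette misses.\<close>

lemma three_color_parts:
  assumes "card (c ` E) = 3"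
  shows "\<exists>P. indexed_partition A {1..3::nat} P \<and>
    (\<forall>i\<in>{1..3}. P i \<noteq> {} \<and> card (incident_colors E c (P i)) \<le> 2)"
proof -
  have fin: "finite (c ` E)" using assms by (intro card_ge_0_finite) simp
  have "\<exists>x \<in> c ` E. x \<notin> palette u" if "u \<in> A" for u
  proof (rule ccontr)
    assume "\<not> ?thesis"
    then have "card (c ` E) \<le> card (palette u)"
      using finite_palette_left[OF that] by (intro card_mono) auto
    then show False using card_palette[of u] that assms by simp
  qed
  then have "\<forall>u\<in>A. \<exists>x. x \<in> c ` E \<and> x \<notin> palette u" by blast
  from bchoice[OF this] obtain g where g: "\<forall>u\<in>A. g u \<in> c ` E \<and> g u \<notin> palette u" by blast
  then have "g ` A \<subseteq> c ` E" by blast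
  then have "card (g ` A) \<le> 3" using card_mono[OF fin] assms by metis
  from refine_fibres[OF finite(1) this card_ge_3(1)]
  obtain h :: "'a \<Rightarrow> nat" where h: "h ` A = {1..3}"
      "\<And>x y. x \<in> A \<Longrightarrow> y \<in> A \<Longrightarrow> h x = h y \<Longrightarrow> g x = g y"
    by blast
  define P where "P i = {u \<in> A. h u = i}" for i
  show ?thesis
  proof (intro exI[of _ P] conjI ballI)
    show "indexed_partition A {1..3} P"
      using indexed_partition_fibres[of "\<lambda>i. i" "{1..3}" h A] h(1) by (simp add: P_def[abs_def])
  next
    fix i :: nat assume "i \<in> {1..3}"
    then have "i \<in> h ` A" using h(1) by simp
    then obtain w where w: "w \<in> A" "h w = i" by blast
    then show "P i \<noteq> {}" by (auto simp: P_def)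
    have "g u = g w" if "u \<in> P i" for u using that by (intro h(2)) (auto simp: P_def w)
    then have "g w \<notin> palette u" if "u \<in> P i" for u
      using that g by (auto simp: P_def)
    then have "incident_colors E c (P i) \<subseteq> c ` E - {g w}"
      unfolding incident_colors_eq_Union[of E c "P i"] Union_palettes_left[symmetric]
      by (auto simp: P_def)
    then have "card (incident_colors E c (P i)) \<le> card (c ` E - {g w})"
      using fin by (intro card_mono) auto
    then show "card (incident_colors E c (P i)) \<le> 2" using g w(1) assms by simp
  qed
qed

end

section \<open>The structures for numbered colors\<close>

locale numbered_palettes = two_color_palettes A B E c
  for A B :: "'a set" and E and c :: "'a set \<Rightarrow> nat"
begin

lemma structure_cI:
  assumes "c ` E = {1..3}"
  shows "structure_c A B E c"
proof -
  interpret swapped: two_color_palettes B A E c by (rule swap)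
  have I: "{1..3} = {1, 2, 3::nat}" by auto
  have three: "card (c ` E) = 3" using assms by simp
  obtain P where P: "indexed_partition A {1..3::nat} P"
      "\<forall>i\<in>{1..3}. P i \<noteq> {} \<and> card (incident_colors E c (P i)) \<le> 2"
    using three_color_parts[OF three] by blast
  obtain Q where Q: "indexed_partition B {1..3::nat} Q"
      "\<forall>i\<in>{1..3}. Q i \<noteq> {} \<and> card (incident_colors E c (Q i)) \<le> 2"
    using swapped.three_color_parts[OF three] by blast
  have "incident_colors E c W \<subseteq> {1, 2, 3}" for W
    using assms I unfolding incident_colors_def by blast
  then show ?thesis unfolding structure_c_def
    using P Q by (intro exI[of _ P] exI[of _ Q]) simp
qed

text \<open>The part with index \<open>1\<close> consists of the vertices with only color \<open>1\<close>, as \<open>{1, 1} = {1}\<close>.\<close>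

lemma common_color_parts:
  assumes "c ` E = {1..k}" "\<And>u. u \<in> A \<Longrightarrow> 1 \<in> palette u"
  shows "indexed_partition A {1..k} (\<lambda>i. {u \<in> A. palette u = {1, i}})"
    and "i \<in> {2..k} \<Longrightarrow> {u \<in> A. palette u = {1, i}} \<noteq> {}"
proof -
  have pair: "palette u = {1, i}" if "u \<in> A" "i \<in> palette u" "i \<noteq> 1" for u i
    by (rule eq_pair_if_card_le_2) (use that assms(2) finite_palette_left card_palette in auto)
  have "palette u \<in> (\<lambda>i. {1, i}) ` {1..k}" if "u \<in> A" for u
  proof (cases "palette u = {1}")
    case True
    then have "1 \<in> {1..k}" using Union_palettes_left that assms(1) by blast
    then show ?thesis using True by blast
  next
    case False
    then obtain i where i: "i \<in> palette u" "i \<noteq> 1" using assms(2) \<open>u \<in> A\<close> by blast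
    then have "i \<in> {1..k}" using Union_palettes_left that assms(1) by blast
    then show ?thesis using pair[OF that i] by blast
  qed
  moreover have "inj_on (\<lambda>i. {1, i}) {1..k}" by (auto simp: inj_on_def doubleton_eq_iff)
  ultimately show "indexed_partition A {1..k} (\<lambda>i. {u \<in> A. palette u = {1, i}})"
    by (intro indexed_partition_fibres) auto
  show "{u \<in> A. palette u = {1, i}} \<noteq> {}" if i: "i \<in> {2..k}"
  proof -
    have "i \<in> c ` E" using assms(1) i by auto
    then obtain u where u: "u \<in> A" "i \<in> palette u" using Union_palettes_left by blast
    moreover have "i \<noteq> 1" using i by auto
    ultimately show ?thesis using pair by blast
  qed
qed

text \<open>Palettes \<open>{1, i}\<close> and \<open>{1, j}\<close> with \<open>i \<noteq> j\<close> share only color \<open>1\<close>, which forces the color of every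
  edge between parts with different indices.\<close>

lemma structure_bI:
  assumes "c ` E = {1..k}" "\<And>w. w \<in> A \<union> B \<Longrightarrow> 1 \<in> palette w"
  shows "structure_b A B E c k"
proof -
  interpret swapped: two_color_palettes B A E c by (rule swap)
  interpret swapped: numbered_palettes B A E c ..
  define P where "P i = {u \<in> A. palette u = {1, i}}" for i
  define Q where "Q i = {v \<in> B. palette v = {1, i}}" for i
  have P: "indexed_partition A {1..k} P" "\<And>i. i \<in> {2..k} \<Longrightarrow> P i \<noteq> {}"
    using common_color_parts[OF assms(1)] assms(2) unfolding P_def by auto
  have Q: "indexed_partition B {1..k} Q" "\<And>i. i \<in> {2..k} \<Longrightarrow> Q i \<noteq> {}"
    using swapped.common_color_parts[OF assms(1)] assms(2) unfolding Q_def by auto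
  have diagonal: "c ` edges_between E (P i) (Q i) \<subseteq> {1, i}" for i
  proof
    fix x assume "x \<in> c ` edges_between E (P i) (Q i)"
    then obtain e where e: "e \<in> edges_between E (P i) (Q i)" "x = c e" by blast
    obtain u v where uv: "e = {u, v}" "u \<in> P i" "v \<in> Q i"
      using e(1) by (rule edges_between_cases)
    then have "u \<in> A" "v \<in> B" "palette u = {1, i}" by (simp_all add: P_def Q_def)
    then show "x \<in> {1, i}" using edge_color_in_palettes[of u v] e(2) uv(1) by simp
  qed
  have rest: "c e = 1" if "e \<in> E" "e \<notin> (\<Union>i\<in>{1..k}. edges_between E (P i) (Q i))" for e
  proof -
    obtain u v where e: "e = {u, v}" "u \<in> A" "v \<in> B" using \<open>e \<in> E\<close> by (rule edges_cases)
    obtain i j where ij: "i \<in> {1..k}" "j \<in> {1..k}" "u \<in> P i" "v \<in> Q j"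
      using P(1) Q(1) e unfolding indexed_partition_def by blast
    then have "i \<noteq> j" using that e unfolding edges_between_def by blast
    then show ?thesis
      using edge_color_in_palettes[OF e(2,3)] ij(3,4) e(1) by (auto simp: P_def Q_def)
  qed
  have "\<forall>i\<in>{2..k}. P i \<noteq> {} \<and> Q i \<noteq> {}" using P(2) Q(2) by blast
  moreover have "\<forall>i\<in>{1..k}. c ` edges_between E (P i) (Q i) \<subseteq> {1, i}"
    using diagonal by blast
  moreover have "\<forall>e\<in>E - (\<Union>i\<in>{1..k}. edges_between E (P i) (Q i)). c e = 1"
    using rest by blast
  ultimately show ?thesis unfolding structure_b_def using P(1) Q(1)
    by (intro exI[of _ P] exI[of _ Q] conjI)
qed

lemma palette_parts:
  assumes "palette ` A = F ` I" "inj_on F I"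
  shows "indexed_partition A I (\<lambda>i. {u \<in> A. palette u = F i})"
    and "i \<in> I \<Longrightarrow> {u \<in> A. palette u = F i} \<noteq> {}"
    and "i \<in> I \<Longrightarrow> incident_colors E c {u \<in> A. palette u = F i} = F i"
proof -
  show "indexed_partition A I (\<lambda>i. {u \<in> A. palette u = F i})"
    using assms by (intro indexed_partition_fibres) auto
  show ne: "{u \<in> A. palette u = F i} \<noteq> {}" if "i \<in> I"
  proof -
    have "F i \<in> palette ` A" using assms that by blast
    then show ?thesis by auto
  qed
  show "incident_colors E c {u \<in> A. palette u = F i} = F i" if "i \<in> I"
    using ne[OF that] incident_colors_eq_Union[of E c "{u \<in> A. palette u = F i}"] by auto
qed

lemma structure_dI:
  assumes "palette ` A = {{1, 2}, {2, 3}, {1, 4}}" "palette ` B = {{1, 2}, {1, 3}, {2, 4}}"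
  shows "structure_d A B E c"
proof -
  interpret swapped: two_color_palettes B A E c by (rule swap)
  interpret swapped: numbered_palettes B A E c ..
  define F :: "nat \<Rightarrow> nat set" where
    "F i = (if i = 1 then {1, 2} else if i = 2 then {2, 3} else {1, 4})" for i
  define G :: "nat \<Rightarrow> nat set" where
    "G i = (if i = 1 then {1, 2} else if i = 2 then {1, 3} else {2, 4})" for i
  have I: "{1..3} = {1, 2, 3::nat}" by auto
  have "palette ` A = F ` {1..3}" "inj_on F {1..3}" "palette ` B = G ` {1..3}" "inj_on G {1..3}"
    unfolding assms I by (auto simp: F_def G_def inj_on_def doubleton_eq_iff)
  note P = palette_parts[OF this(1,2)] and Q = swapped.palette_parts[OF this(3,4)]
  have "F i \<in> {{1, 2}, {2, 3}, {1, 4}}" "G i \<in> {{1, 2}, {1, 3}, {2, 4}}" for i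
    by (auto simp: F_def G_def)
  then show ?thesis unfolding structure_d_def
    using P Q by (intro exI[of _ "\<lambda>i. {u \<in> A. palette u = F i}"]
        exI[of _ "\<lambda>i. {v \<in> B. palette v = G i}"]) simp
qed

text \<open>Each of the two palettes on the left has exactly one color in common with each of the four
  possible palettes on the right, so the palettes of its ends determine the color of an edge.\<close>

lemma structure_eI:
  assumes "palette ` A = {{1, 4}, {2, 3}}"
    and "palette ` B \<subseteq> {{1, 2}, {1, 3}, {2, 4}, {3, 4}}"
  shows "structure_e A B E c"
proof -
  define F :: "nat \<Rightarrow> nat set" where
    "F i = (if i = 1 then {1, 4} else {2, 3})" for i
  define G :: "nat \<Rightarrow> nat set" where
    "G i = (if i = 1 then {1, 2} else if i = 2 then {1, 3} else if i = 3 then {2, 4} else {3, 4})"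
    for i
  define P where "P i = {u \<in> A. palette u = F i}" for i
  define Q where "Q i = {v \<in> B. palette v = G i}" for i
  have I: "{1..2} = {1, 2::nat}" "{1..4} = {1, 2, 3, 4::nat}" by auto
  have "palette ` A = F ` {1..2}" "inj_on F {1..2}"
    unfolding assms I by (auto simp: F_def inj_on_def doubleton_eq_iff)
  note parts = palette_parts[OF this, folded P_def]
  have "G ` {1..4} = {{1, 2}, {1, 3}, {2, 4}, {3, 4}}" "inj_on G {1..4}"
    unfolding I by (auto simp: G_def inj_on_def doubleton_eq_iff)
  then have Q: "indexed_partition B {1..4} Q"
    unfolding Q_def using assms(2) by (intro indexed_partition_fibres) simp_all
  have "all_colored E c (P 1) (Q 1 \<union> Q 2) 1" "all_colored E c (P 1) (Q 3 \<union> Q 4) 4"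
    "all_colored E c (P 2) (Q 1 \<union> Q 3) 2" "all_colored E c (P 2) (Q 2 \<union> Q 4) 3"
    by (rule all_coloredI; auto simp: P_def Q_def F_def G_def)+
  then show ?thesis unfolding structure_e_def
    using parts(1,2) Q by blast
qed

end

section \<open>The classification\<close>

lemma bij_betw_numbering_with_first:
  assumes "finite K" "x \<in> K"
  obtains \<sigma> :: "'c \<Rightarrow> nat" where "bij_betw \<sigma> K {1..card K}" "\<sigma> x = 1"
proof -
  have "card (K - {x}) = card {2..card K}" using assms by simp
  then obtain \<tau> where \<tau>: "bij_betw \<tau> (K - {x}) {2..card K}"
    using finite_same_card_bij[of "K - {x}" "{2..card K}"] assms by auto
  have "bij_betw (\<tau>(x := 1)) ((K - {x}) \<union> {x}) ({2..card K} \<union> {1})"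
  proof (rule bij_betw_combine)
    have "bij_betw (\<tau>(x := 1)) (K - {x}) {2..card K} = bij_betw \<tau> (K - {x}) {2..card K}"
      by (intro bij_betw_cong) auto
    then show "bij_betw (\<tau>(x := 1)) (K - {x}) {2..card K}" using \<tau> by blast
  qed auto
  moreover have "(K - {x}) \<union> {x} = K" using assms by auto
  moreover have "{2..card K} \<union> {1} = {1..card K}"
    using assms by (auto simp: Suc_le_eq card_gt_0_iff)
  ultimately show thesis using that[of "\<tau>(x := 1)"] by simp
qed

theorem theorem2p1:
  fixes U V :: "'a set" and E :: "'a set set" and c :: "'a set \<Rightarrow> 'c" and n k :: nat
  assumes "n \<ge> 3"
    and "finite U" and "finite V" and "U \<inter> V = {}" and "card U = n" and "card V = n"
    and "E = complete_bipartite_edges U V"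
    and "\<not> contains_rainbow_complete_bipartite 1 3 E c"
    and "k = card (c ` E)"
  shows "\<exists>\<sigma> :: 'c \<Rightarrow> nat. \<exists>A B. bij_betw \<sigma> (c ` E) {1..k} \<and> (A, B) \<in> {(U, V), (V, U)} \<and>
           (k \<le> 2
            \<or> structure_b A B E (\<sigma> \<circ> c) k
            \<or> structure_c A B E (\<sigma> \<circ> c)
            \<or> structure_d A B E (\<sigma> \<circ> c)
            \<or> structure_e A B E (\<sigma> \<circ> c))"
proof -
  have "card (incident_colors E c {w}) \<le> 2" if "w \<in> U \<union> V" for w
  proof -
    have "V \<inter> U = {}" "E = complete_bipartite_edges V U"
      using assms(4,7) complete_bipartite_edges_commute by auto
    then show ?thesis
      using that card_palette_le_2[OF assms(4,7,8)] card_palette_le_2[OF _ _ assms(8)] by blast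
  qed
  then interpret two_color_palettes U V E c
    using assms by unfold_locales auto
  interpret swapped: two_color_palettes V U E c by (rule swap)
  have numbered: "numbered_palettes U V E (\<sigma> \<circ> c)" "numbered_palettes V U E (\<sigma> \<circ> c)"
    for \<sigma> :: "'c \<Rightarrow> nat"
    using recolor[of \<sigma>] swapped.recolor[of \<sigma>] by (simp_all add: numbered_palettes.intro)
  have palette_image: "(\<lambda>w. incident_colors E (\<sigma> \<circ> c) {w}) ` W = (`) \<sigma> ` palette ` W"
    for \<sigma> :: "'c \<Rightarrow> nat" and W
    by (simp add: incident_colors_comp image_comp)
  have "finite (c ` E)"
    unfolding Union_palettes_left[symmetric] using finite_palette_left assms(2) by blast
  then obtain \<sigma> :: "'c \<Rightarrow> nat" where \<sigma>: "bij_betw \<sigma> (c ` E) {1..k}"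
    using finite_same_card_bij[of "c ` E" "{1..k}"] assms by auto
  let ?R = "palette ` U" and ?C = "palette ` V"
  have "k \<le> 2 \<or> k = 3 \<or> k \<ge> 4" by linarith
  then consider "k \<le> 2" | "k = 3" | x where "k \<ge> 4" "\<forall>X\<in>?R \<union> ?C. x \<in> X"
    | "k \<ge> 4" "\<nexists>x. \<forall>X\<in>?R \<union> ?C. x \<in> X"
    by blast
  then show ?thesis
  proof cases
    case 1
    then show ?thesis using \<sigma> by blast
  next
    case 2
    then have "(\<sigma> \<circ> c) ` E = {1..3}" using bij_betw_imp_surj_on[OF \<sigma>] by (simp only: image_comp)
    then have "structure_c U V E (\<sigma> \<circ> c)" by (rule numbered_palettes.structure_cI[OF numbered(1)])
    then show ?thesis using \<sigma> by blast
  next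
    case (3 x)
    obtain u where "u \<in> U" using card_ge_3(1) by fastforce
    then have "x \<in> palette u" using 3(2) by blast
    then have "x \<in> c ` E" using \<open>u \<in> U\<close> Union_palettes_left by blast
    from bij_betw_numbering_with_first[OF \<open>finite (c ` E)\<close> this, folded assms(9)]
    obtain \<tau> :: "'c \<Rightarrow> nat" where \<tau>: "bij_betw \<tau> (c ` E) {1..k}" "\<tau> x = 1" .
    have "1 \<in> incident_colors E (\<tau> \<circ> c) {w}" if "w \<in> U \<union> V" for w
    proof -
      have "x \<in> palette w" using 3(2) that by blast
      then have "\<tau> x \<in> \<tau> ` palette w" by (rule imageI)
      then show ?thesis using \<tau>(2) by (simp only: incident_colors_comp)
    qed
    moreover have "(\<tau> \<circ> c) ` E = {1..k}"
      using bij_betw_imp_surj_on[OF \<tau>(1)] by (simp only: image_comp)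
    ultimately have "structure_b U V E (\<tau> \<circ> c) k"
      by (intro numbered_palettes.structure_bI[OF numbered(1)])
    then show ?thesis using \<tau> by blast
  next
    case 4
    have fin: "finite X" if "X \<in> ?R \<union> ?C" for X
      using that finite_palette_left swapped.finite_palette_left by blast
    have card_le: "card X \<le> 2" if "X \<in> ?R \<union> ?C" for X
      using that card_palette by blast
    have cross: "X \<inter> Y \<noteq> {}" if "X \<in> ?R" "Y \<in> ?C" for X Y
      using that edge_color_in_palettes by blast
    have large: "card (c ` E) \<ge> 4" using 4(1) assms(9) by simp
    obtain p q r s where pqrs: "distinct [p, q, r, s]" "c ` E = {p, q, r, s}"
      and cases: "?R = {{p, s}, {q, r}} \<and> ?C \<subseteq> {{p, q}, {p, r}, {q, s}, {r, s}} \<or>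
         ?C = {{p, s}, {q, r}} \<and> ?R \<subseteq> {{p, q}, {p, r}, {q, s}, {r, s}} \<or>
         ?R = {{p, q}, {q, r}, {p, s}} \<and> ?C = {{p, q}, {p, r}, {q, s}}"
      by (rule cross_intersecting_pairs[OF fin card_le cross Union_palettes_left
            swapped.Union_palettes_left large 4(2)])
    \<comment> \<open>Colors numbered in the order of the cycle \<open>pqrs\<close> give the palettes of (d) and (e) literally.\<close>
    define \<tau> :: "'c \<Rightarrow> nat" where
      "\<tau> x = (if x = p then 1 else if x = q then 2 else if x = r then 3 else 4)" for x
    have \<tau>_simps: "\<tau> p = 1" "\<tau> q = 2" "\<tau> r = 3" "\<tau> s = 4"
      using pqrs(1) by (auto simp: \<tau>_def)
    have "k = 4" using pqrs assms(9) by simp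
    moreover have "{1..4} = {1, 2, 3, 4::nat}" by auto
    ultimately have \<tau>: "bij_betw \<tau> (c ` E) {1..k}"
      unfolding pqrs(2) bij_betw_def inj_on_def using \<tau>_simps by auto
    have image_subset: "(\<lambda>w. incident_colors E (\<tau> \<circ> c) {w}) ` W
        \<subseteq> {{1, 2}, {1, 3}, {2, 4}, {3, 4}}"
      if "palette ` W \<subseteq> {{p, q}, {p, r}, {q, s}, {r, s}}" for W
      unfolding palette_image using image_mono[OF that, of "(`) \<tau>"] by (simp add: \<tau>_simps)
    from cases consider
        "?R = {{p, s}, {q, r}}" "?C \<subseteq> {{p, q}, {p, r}, {q, s}, {r, s}}"
      | "?C = {{p, s}, {q, r}}" "?R \<subseteq> {{p, q}, {p, r}, {q, s}, {r, s}}"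
      | "?R = {{p, q}, {q, r}, {p, s}}" "?C = {{p, q}, {p, r}, {q, s}}"
      by argo
    then have "structure_e U V E (\<tau> \<circ> c) \<or> structure_e V U E (\<tau> \<circ> c) \<or> structure_d U V E (\<tau> \<circ> c)"
    proof cases
      case 1
      then have "structure_e U V E (\<tau> \<circ> c)"
        by (intro numbered_palettes.structure_eI[OF numbered(1)] image_subset)
          (simp_all only: palette_image image_insert image_empty \<tau>_simps)
      then show ?thesis by blast
    next
      case 2
      then have "structure_e V U E (\<tau> \<circ> c)"
        by (intro numbered_palettes.structure_eI[OF numbered(2)] image_subset)
          (simp_all only: palette_image image_insert image_empty \<tau>_simps)
      then show ?thesis by blast
    next
      case 3
      then have "structure_d U V E (\<tau> \<circ> c)"
        by (intro numbered_palettes.structure_dI[OF numbered(1)])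
          (simp_all only: palette_image image_insert image_empty \<tau>_simps)
      then show ?thesis by blast
    qed
    then show ?thesis using \<tau> by blast
  qed
qed

end
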